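(* Let $0<\alpha<1$ and $0<\zeta<1-\alpha$. Suppose that $n_{\min}\to\infty$ and $K\to\infty$. Consider the class of sparse alternatives $\mathcal F_h(\epsilon_N)$ defined with a translation invariant kernel $h$ on $\mathbb R^d$, $h(x,y)=\varphi(x-y)$. Assume that there exist $z\in\mathbb R^d$ and $\kappa_1,\kappa_2>0$ such that $\varphi(0)-\varphi(z)\ge\kappa_1$ and $r_N^\star:=\sqrt{\log K/n_{\min}}\le\kappa_2$ for all $n_{\min}$. Further assume that (B1) and (B2) (stated in the context) hold. Then under $H_1$, there exists a small constant $b>0$ such that $$\liminf_{n_{\min}\to\infty}\ \inf_{\phi\in\Phi_N(\alpha)}\ \sup_{(P_1,\ldots,P_K)\in\mathcal F_h(br_N^\star)}\mathbb P(\phi=0)\ge\zeta,$$ where $\Phi_N(\alpha)$ is the set of all level $\alpha$ test functions $\phi:\{Z_1,\ldots,Z_N\}\mapsto\{0,1\}$.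
   Context: A kernel $h:\mathbb R^d\times\mathbb R^d\to\mathbb R$ is translation invariant if there is a symmetric positive definite function $\varphi:\mathbb R^d\to\mathbb R$ with $\varphi(x-y)=h(x,y)$ for all $x,y\in\mathbb R^d$. The kernel $h$ is fixed, with reproducing kernel Hilbert space $\mathcal H$ and feature map $\psi$, $h(x,y)=\langle\psi(x),\psi(y)\rangle_{\mathcal H}$. $X_{1,k},\ldots,X_{n_k,k}\sim P_k$, $k=1,\ldots,K$, are all mutually independent, with $P_k$ probability distributions on $\mathbb R^d$; $N=\sum_kn_k$; $n_{\max},n_{\min}$ are the maximum and minimum of $\{n_1,\ldots,n_K\}$; $\{Z_1,\ldots,Z_N\}=\{X_{1,1},\ldots,X_{n_K,K}\}$ is the pooled sample, listed sample by sample. $K$ and $n_1,\ldots,n_K$ vary along a sequence with $K\to\infty$, $n_{\min}\to\infty$. Maximum mean discrepancy: $\mathcal V_h(P,Q)=\|\mathbb E_{X\sim P}[\psi(X)]-\mathbb E_{Y\sim Q}[\psi(Y)]\|_{\mathcal H}$. For $\epsilon>0$, $$\mathcal F_h(\epsilon)=\big\{(P_1,\ldots,P_K):\text{each }P_k\text{ is a probability distribution on }\mathbb R^d,\ \max_{1\le k<l\le K}\mathcal V_h(P_k,P_l)\ge\epsilon\big\}.$$ A test $\phi$ (a measurable $\{0,1\}$-valued function of the pooled data, $\phi=1$ meaning rejection) has level $\alpha$ if $\mathbb P(\phi=1)\le\alpha$ whenever $P_1=\cdots=P_K$. "Under $H_1$" means that $\mathbb P(\phi=0)$ is computed under the alternative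 $(P_1,\ldots,P_K)$. The constant $b$ does not depend on $N$ or $K$. (B1) There is a constant $B$ with $0\le h(x,y)\le B$ for all $x,y\in\mathbb R^d$. (B2) There exists a fixed constant $c>0$ such that $n_{\max}/n_{\min}\le c$ for any sample sizes considered. *)

theory Defs
  imports "HOL-Probability.Probability"
begin

(* Positive definite in the usual non-strict sense. *)
definition symmetric_positive_definite :: "('a::ab_group_add \<Rightarrow> real) \<Rightarrow> bool" where
  "symmetric_positive_definite \<phi> \<longleftrightarrow>
     (\<forall>x. \<phi> (- x) = \<phi> x) \<and>
     (\<forall>S a. finite S \<longrightarrow> 0 \<le> (\<Sum>x\<in>S. \<Sum>y\<in>S. a x * a y * \<phi> (x - y)))"

definition translation_invariant_with ::
  "('a::ab_group_add \<Rightarrow> 'a \<Rightarrow> real) \<Rightarrow> ('a \<Rightarrow> real) \<Rightarrow> bool" where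
  "translation_invariant_with h \<phi> \<longleftrightarrow>
     symmetric_positive_definite \<phi> \<and> (\<forall>x y. \<phi> (x - y) = h x y)"

(* Hilbert spaces whose elements are real functions on 'a. Since the carrier depends on the
   kernel, it is a set with an explicit inner product ip, not a type. *)
definition ip_norm :: "(('a \<Rightarrow> real) \<Rightarrow> ('a \<Rightarrow> real) \<Rightarrow> real) \<Rightarrow> ('a \<Rightarrow> real) \<Rightarrow> real" where
  "ip_norm ip f = sqrt (ip f f)"

locale hilbert_function_space =
  fixes H :: "('a \<Rightarrow> real) set"
    and ip :: "('a \<Rightarrow> real) \<Rightarrow> ('a \<Rightarrow> real) \<Rightarrow> real"
  assumes zero_mem: "(\<lambda>_. 0) \<in> H"
    and add_mem: "\<And>f g. f \<in> H \<Longrightarrow> g \<in> H \<Longrightarrow> (\<lambda>x. f x + g x) \<in> H"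
    and scale_mem: "\<And>c f. f \<in> H \<Longrightarrow> (\<lambda>x. c * f x) \<in> H"
    and ip_commute: "\<And>f g. f \<in> H \<Longrightarrow> g \<in> H \<Longrightarrow> ip f g = ip g f"
    and ip_add_left: "\<And>f g k. f \<in> H \<Longrightarrow> g \<in> H \<Longrightarrow> k \<in> H \<Longrightarrow>
                        ip (\<lambda>x. f x + g x) k = ip f k + ip g k"
    and ip_scale_left: "\<And>c f g. f \<in> H \<Longrightarrow> g \<in> H \<Longrightarrow> ip (\<lambda>x. c * f x) g = c * ip f g"
    and ip_nonneg: "\<And>f. f \<in> H \<Longrightarrow> 0 \<le> ip f f"
    and ip_definite: "\<And>f. f \<in> H \<Longrightarrow> ip f f = 0 \<Longrightarrow> f = (\<lambda>_. 0)"
    and complete: "Metric_space.mcomplete H (\<lambda>f g. ip_norm ip (\<lambda>x. f x - g x))"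

locale rkhs = hilbert_function_space H ip
  for h :: "'a \<Rightarrow> 'a \<Rightarrow> real"
    and H :: "('a \<Rightarrow> real) set"
    and ip :: "('a \<Rightarrow> real) \<Rightarrow> ('a \<Rightarrow> real) \<Rightarrow> real" +
  assumes kernel_mem: "\<And>x. h x \<in> H"
    and reproducing: "\<And>f x. f \<in> H \<Longrightarrow> ip f (h x) = f x"

definition feature_map ::
  "('a \<Rightarrow> 'a \<Rightarrow> real) \<Rightarrow> ('a \<Rightarrow> real) set \<Rightarrow> (('a \<Rightarrow> real) \<Rightarrow> ('a \<Rightarrow> real) \<Rightarrow> real) \<Rightarrow>
     ('a \<Rightarrow> ('a \<Rightarrow> real)) \<Rightarrow> bool" where
  "feature_map h H ip \<psi> \<longleftrightarrow> (\<forall>x. \<psi> x \<in> H) \<and> (\<forall>x y. h x y = ip (\<psi> x) (\<psi> y))"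

(* The expectation of psi(X) in H, for X distributed as P. It is the weak (Pettis) integral,
   which for a bounded Borel measurable kernel exists and is unique for every P (Riesz), also
   when H is not separable; it agrees with the Bochner integral whenever the latter exists. *)
definition mean_embedding ::
  "('a \<Rightarrow> real) set \<Rightarrow> (('a \<Rightarrow> real) \<Rightarrow> ('a \<Rightarrow> real) \<Rightarrow> real) \<Rightarrow> ('a \<Rightarrow> ('a \<Rightarrow> real)) \<Rightarrow>
     'a measure \<Rightarrow> ('a \<Rightarrow> real)" where
  "mean_embedding H ip \<psi> P =
     (THE m. m \<in> H \<and> (\<forall>f\<in>H. ip m f = (\<integral>x. ip (\<psi> x) f \<partial>P)))"

definition mmd ::
  "('a \<Rightarrow> real) set \<Rightarrow> (('a \<Rightarrow> real) \<Rightarrow> ('a \<Rightarrow> real) \<Rightarrow> real) \<Rightarrow> ('a \<Rightarrow> ('a \<Rightarrow> real)) \<Rightarrow>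
     'a measure \<Rightarrow> 'a measure \<Rightarrow> real" where
  "mmd H ip \<psi> P Q =
     ip_norm ip (\<lambda>x. mean_embedding H ip \<psi> P x - mean_embedding H ip \<psi> Q x)"

(* K-tuples (P_1, ..., P_K) of Borel probability distributions; only the values of P on {1..K}
   are constrained. *)
definition distribution_tuples :: "nat \<Rightarrow> (nat \<Rightarrow> 'a::topological_space measure) set" where
  "distribution_tuples K = {1..K} \<rightarrow> space (prob_algebra borel)"

definition sparse_alternatives ::
  "('a::topological_space \<Rightarrow> real) set \<Rightarrow> (('a \<Rightarrow> real) \<Rightarrow> ('a \<Rightarrow> real) \<Rightarrow> real) \<Rightarrow>
     ('a \<Rightarrow> ('a \<Rightarrow> real)) \<Rightarrow> nat \<Rightarrow> real \<Rightarrow> (nat \<Rightarrow> 'a measure) set" where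
  "sparse_alternatives H ip \<psi> K \<epsilon> =
     {P \<in> distribution_tuples K.
        \<epsilon> \<le> Max {mmd H ip \<psi> (P k) (P l) | k l. 1 \<le> k \<and> k < l \<and> l \<le> K}}"

definition total_size :: "nat \<Rightarrow> (nat \<Rightarrow> nat) \<Rightarrow> nat" where
  "total_size K n = (\<Sum>k=1..K. n k)"

definition n_min :: "nat \<Rightarrow> (nat \<Rightarrow> nat) \<Rightarrow> nat" where
  "n_min K n = Min (n ` {1..K})"

definition n_max :: "nat \<Rightarrow> (nat \<Rightarrow> nat) \<Rightarrow> nat" where
  "n_max K n = Max (n ` {1..K})"

definition rate :: "nat \<Rightarrow> (nat \<Rightarrow> nat) \<Rightarrow> real" where
  "rate K n = sqrt (ln (real K) / real (n_min K n))"

(* The sample to which Z_i belongs when the pooled sample is listed sample by sample: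
   n_1 + ... + n_(k-1) < i <= n_1 + ... + n_k. *)
definition sample_of :: "(nat \<Rightarrow> nat) \<Rightarrow> nat \<Rightarrow> nat" where
  "sample_of n i = (LEAST k. i \<le> (\<Sum>j=1..k. n j))"

(* The joint law of (Z_1, ..., Z_N) under (P_1, ..., P_K). *)
definition pooled_law ::
  "nat \<Rightarrow> (nat \<Rightarrow> nat) \<Rightarrow> (nat \<Rightarrow> 'a measure) \<Rightarrow> (nat \<Rightarrow> 'a) measure" where
  "pooled_law K n P = (\<Pi>\<^sub>M i\<in>{1..total_size K n}. P (sample_of n i))"

definition prob_test_eq ::
  "nat \<Rightarrow> (nat \<Rightarrow> nat) \<Rightarrow> (nat \<Rightarrow> 'a measure) \<Rightarrow> ((nat \<Rightarrow> 'a) \<Rightarrow> nat) \<Rightarrow> nat \<Rightarrow> real" where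
  "prob_test_eq K n P T v =
     measure (pooled_law K n P) {z \<in> space (pooled_law K n P). T z = v}"

definition level_tests ::
  "real \<Rightarrow> nat \<Rightarrow> (nat \<Rightarrow> nat) \<Rightarrow> ((nat \<Rightarrow> 'a::topological_space) \<Rightarrow> nat) set" where
  "level_tests \<alpha> K n =
     {T \<in> (\<Pi>\<^sub>M i\<in>{1..total_size K n}. borel) \<rightarrow>\<^sub>M count_space {0, 1}.
        \<forall>P \<in> distribution_tuples K. (\<forall>k\<in>{1..K}. \<forall>l\<in>{1..K}. P k = P l) \<longrightarrow>
          prob_test_eq K n P T 1 \<le> \<alpha>}"

end

theory Submission
  imports Defs "HOL-Real_Asymp.Real_Asymp"
begin

text \<open>
  The lower bound comes from comparing the null hypothesis with a mixture of alternatives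
  (the second moment method of Ingster and Le Cam). Let \<open>P\<^sub>0\<close> be the uniform law on the two points
  \<open>0\<close> and \<open>z\<close>, and let \<open>Q\<close> have density \<open>1 + \<eta>\<close> at \<open>0\<close> and \<open>1 - \<eta>\<close> at \<open>z\<close>
  with respect to \<open>P\<^sub>0\<close>, where \<open>\<eta>\<close> is a small multiple of \<open>sqrt (ln K / n_min)\<close>. Under the
  alternative number \<open>j\<close>, the sample \<open>j\<close> has law \<open>Q\<close> and all others have law \<open>P\<^sub>0\<close>.

  The mean embeddings of \<open>Q\<close> and \<open>P\<^sub>0\<close> differ by \<open>(\<eta> / 2) (\<psi> 0 - \<psi> z)\<close>, whose norm is
  \<open>(\<eta> / 2) sqrt (2 (\<phi> 0 - \<phi> z))\<close>, so each of these alternatives is separated at the rate in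
  question (\<open>mmd_two_point\<close>, \<open>one_tilted_sample_sparse\<close>). The mean embedding is a weak integral
  over all of the Hilbert space, which makes the measurability of \<open>x \<mapsto> ip (\<psi> x) f\<close> for
  arbitrary \<open>f\<close> necessary; this is \<open>measurable_ip_feature\<close>.

  The likelihood ratio of the uniform mixture of the \<open>K\<close> alternatives has mean \<open>1\<close> under the null.
  Its components involve disjoint samples and are uncorrelated, and the second moment of component
  \<open>j\<close> is at most \<open>(1 + \<eta>\<^sup>2)\<close> to the power \<open>n\<^sub>j\<close>, which is at most \<open>sqrt K\<close> for a suitable
  multiple (\<open>likelihood_second_moment_le\<close>). So the variance of the mixture ratio is at most
  \<open>1 / sqrt K\<close>, and a level \<open>\<alpha>\<close> test accepts with average probability at least
  \<open>1 - \<alpha> - o(1)\<close> over the alternatives (\<open>mixture_lower_bound\<close>), hence with at least this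
  probability for one of them.
\<close>

section \<open>Mean embeddings under a feature map\<close>

context hilbert_function_space
begin

lemma ip_add_right:
  assumes "f \<in> H" "g \<in> H" "k \<in> H"
  shows "ip k (\<lambda>x. f x + g x) = ip k f + ip k g"
  using assms ip_add_left[of f g k] ip_commute[of k] add_mem[of f g] by simp

lemma ip_scale_right:
  assumes "f \<in> H" "g \<in> H"
  shows "ip g (\<lambda>x. r * f x) = r * ip g f"
  using assms ip_scale_left[of f g r] ip_commute[of g] scale_mem[of f r] by simp

lemma diff_mem:
  assumes "f \<in> H" "g \<in> H"
  shows "(\<lambda>x. f x - g x) \<in> H"
  using add_mem[OF assms(1) scale_mem[OF assms(2), of "-1"]] by simp

lemma ip_diff_left:
  assumes "f \<in> H" "g \<in> H" "k \<in> H"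
  shows "ip (\<lambda>x. f x - g x) k = ip f k - ip g k"
  using ip_add_left[OF assms(1) scale_mem[OF assms(2), of "-1"] assms(3)]
    ip_scale_left[OF assms(2,3), of "-1"] by simp

lemma ip_diff_right:
  assumes "f \<in> H" "g \<in> H" "k \<in> H"
  shows "ip k (\<lambda>x. f x - g x) = ip k f - ip k g"
  using ip_diff_left[OF assms] ip_commute[of k] diff_mem[of f g] assms by simp

lemma ip_diff_self:
  assumes "f \<in> H" "g \<in> H"
  shows "ip (\<lambda>x. f x - g x) (\<lambda>x. f x - g x) = ip f f - 2 * ip f g + ip g g"
  using assms by (simp add: ip_diff_left ip_diff_right diff_mem ip_commute[of g f])

text \<open>Only \<open>x \<mapsto> ip (\<psi> x) (\<psi> y) = h x y\<close> is measurable by assumption, while the mean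
  embedding tests against every element of \<open>H\<close>. The elements of \<open>H\<close> with a measurable pairing
  form a subspace containing the range of \<open>\<psi>\<close>; along a sequence in it that minimises the distance
  to \<open>f\<close>, the pairings with \<open>\<psi> x\<close> converge pointwise to the pairing of \<open>f\<close>. The
  sequence itself need not converge, so completeness plays no role.\<close>

lemma measurable_ip_feature:
  assumes feature: "feature_map h H ip \<psi>"
    and kernel: "\<And>y. (\<lambda>x. h x y) \<in> borel_measurable M"
    and f: "f \<in> H"
  shows "(\<lambda>x. ip (\<psi> x) f) \<in> borel_measurable M"
proof -
  define S where "S = {g \<in> H. (\<lambda>x. ip (\<psi> x) g) \<in> borel_measurable M}"
  have psi: "\<psi> x \<in> H" and psi_ip: "ip (\<psi> x) (\<psi> y) = h x y" for x y
    using feature by (auto simp: feature_map_def)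
  have S_sub: "g \<in> H" if "g \<in> S" for g using that by (simp add: S_def)
  have S_add: "(\<lambda>y. g y + r * \<psi> x y) \<in> S" if "g \<in> S" for g r x
    using that psi kernel
    by (auto simp: S_def add_mem scale_mem ip_add_right ip_scale_right psi_ip)
  have S_zero: "(\<lambda>_. 0) \<in> S"
    using ip_scale_right[of "\<lambda>_. 0" _ 0] zero_mem psi by (simp add: S_def zero_mem)
  define D where "D g = ip (\<lambda>x. f x - g x) (\<lambda>x. f x - g x)" for g
  have D_nonneg: "0 \<le> D g" if "g \<in> S" for g
    unfolding D_def by (rule ip_nonneg[OF diff_mem[OF f S_sub[OF that]]])
  define d where "d = Inf (D ` S)"
  have bdd: "bdd_below (D ` S)"
    by (rule bdd_belowI2[of _ 0]) (rule D_nonneg)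
  have d_le: "d \<le> D g" if "g \<in> S" for g
    unfolding d_def by (rule cInf_lower[OF imageI[OF that] bdd])
  have "\<forall>m. \<exists>g. g \<in> S \<and> D g < d + 1 / real (Suc m)"
  proof
    fix m
    have "D ` S \<noteq> {}" using S_zero by blast
    moreover have "Inf (D ` S) < d + 1 / real (Suc m)"
      unfolding d_def[symmetric] by simp
    ultimately have "\<exists>t\<in>D ` S. t < d + 1 / real (Suc m)" by (rule cInf_lessD)
    then show "\<exists>g. g \<in> S \<and> D g < d + 1 / real (Suc m)" by blast
  qed
  then obtain u where u: "\<And>m. u m \<in> S" "\<And>m. D (u m) < d + 1 / real (Suc m)"
    by (auto dest!: choice)
  \<comment> \<open>Near-optimality of the approximant against its perturbation by a multiple of
    \<open>\<psi> x\<close> forces the residual to be nearly orthogonal to \<open>\<psi> x\<close>.\<close>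
  have bound: "(ip (\<psi> x) f - ip (\<psi> x) (u m))\<^sup>2 \<le> (h x x + 1) * (1 / real (Suc m))" for x m
  proof -
    define w where "w = (\<lambda>y. f y - u m y)"
    define s where "s = ip w (\<psi> x)"
    \<comment> \<open>The optimal step is \<open>s / h x x\<close>; adding \<open>1\<close> covers the case \<open>h x x = 0\<close>.\<close>
    define r where "r = s / (h x x + 1)"
    have w: "w \<in> H" unfolding w_def by (intro diff_mem f S_sub u)
    have hx: "0 \<le> h x x" using ip_nonneg[OF psi, of x] psi_ip by simp
    have "d \<le> D (\<lambda>y. u m y + r * \<psi> x y)" by (intro d_le S_add u)
    also have "\<dots> = ip (\<lambda>y. w y - r * \<psi> x y) (\<lambda>y. w y - r * \<psi> x y)"
      unfolding D_def w_def by (simp add: algebra_simps)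
    also have "\<dots> = D (u m) - 2 * r * s + r\<^sup>2 * h x x"
      using ip_diff_self[OF w scale_mem[OF psi, of r x]] w psi[of x]
      by (simp add: ip_scale_left ip_scale_right scale_mem psi_ip D_def s_def
          power2_eq_square flip: w_def)
    also have "\<dots> < d + 1 / real (Suc m) - 2 * r * s + r\<^sup>2 * h x x"
      using u(2)[of m] by simp
    finally have "2 * r * s - r\<^sup>2 * h x x \<le> 1 / real (Suc m)" by simp
    moreover have "s\<^sup>2 / (h x x + 1) \<le> 2 * r * s - r\<^sup>2 * h x x"
    proof -
      have s: "s = r * (h x x + 1)" using hx by (simp add: r_def)
      have "s\<^sup>2 / (h x x + 1) = r * s"
        using hx by (simp add: r_def power2_eq_square)
      moreover have "2 * r * s - r\<^sup>2 * h x x = r * s + r\<^sup>2"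
        by (simp add: s power2_eq_square algebra_simps)
      moreover have "0 \<le> r\<^sup>2" by simp
      ultimately show ?thesis by linarith
    qed
    ultimately have "s\<^sup>2 / (h x x + 1) \<le> 1 / real (Suc m)" by linarith
    then have "s\<^sup>2 \<le> (h x x + 1) * (1 / real (Suc m))"
      using hx by (simp add: divide_simps mult.commute)
    moreover have "s = ip (\<psi> x) f - ip (\<psi> x) (u m)"
      unfolding s_def w_def using f psi S_sub[OF u(1)]
      by (simp add: ip_diff_left ip_commute[of _ "\<psi> x"])
    ultimately show ?thesis by simp
  qed
  have lim: "(\<lambda>m. ip (\<psi> x) (u m)) \<longlonglongrightarrow> ip (\<psi> x) f" for x
  proof -
    have "(\<lambda>m. (h x x + 1) * (1 / real (Suc m))) \<longlonglongrightarrow> 0"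
      by (rule tendsto_mult_right_zero[OF LIMSEQ_Suc[OF lim_1_over_n]])
    moreover have "\<forall>\<^sub>F m in sequentially.
        0 \<le> (ip (\<psi> x) f - ip (\<psi> x) (u m))\<^sup>2"
      by (rule always_eventually) simp
    moreover have "\<forall>\<^sub>F m in sequentially.
        (ip (\<psi> x) f - ip (\<psi> x) (u m))\<^sup>2 \<le> (h x x + 1) * (1 / real (Suc m))"
      by (rule always_eventually) (rule allI, rule bound)
    ultimately have "(\<lambda>m. (ip (\<psi> x) f - ip (\<psi> x) (u m))\<^sup>2) \<longlonglongrightarrow> 0"
      using tendsto_sandwich tendsto_const by fast
    then have "(\<lambda>m. ip (\<psi> x) f - ip (\<psi> x) (u m)) \<longlonglongrightarrow> 0"
      using tendsto_real_sqrt[of "\<lambda>m. (ip (\<psi> x) f - ip (\<psi> x) (u m))\<^sup>2" 0]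
      by (simp add: tendsto_rabs_zero_iff)
    then show ?thesis
      by (rule iffD1[OF Lim_transform_eq tendsto_const])
  qed
  show ?thesis
    using u(1) by (intro borel_measurable_LIMSEQ_real[OF lim]) (auto simp: S_def)
qed

lemma mean_embedding_eqI:
  assumes m: "m \<in> H" and int: "\<And>f. f \<in> H \<Longrightarrow> ip m f = (\<integral>x. ip (\<psi> x) f \<partial>P)"
  shows "mean_embedding H ip \<psi> P = m"
  unfolding mean_embedding_def
proof (rule the_equality)
  fix m' assume m': "m' \<in> H \<and> (\<forall>f\<in>H. ip m' f = (\<integral>x. ip (\<psi> x) f \<partial>P))"
  have "ip (\<lambda>x. m' x - m x) (\<lambda>x. m' x - m x) = 0"
    using m m' int[OF diff_mem[of m' m]] by (subst ip_diff_left) (simp_all add: diff_mem)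
  then have "(\<lambda>x. m' x - m x) = (\<lambda>_. 0)"
    using m m' by (intro ip_definite diff_mem) auto
  then show "m' = m" by (simp add: fun_eq_iff)
qed (use m int in auto)

lemma mmd_commute:
  assumes "mean_embedding H ip \<psi> P \<in> H" "mean_embedding H ip \<psi> Q \<in> H"
  shows "mmd H ip \<psi> P Q = mmd H ip \<psi> Q P"
  using assms by (simp add: mmd_def ip_norm_def ip_diff_self ip_commute)

lemma mean_embedding_two_point:
  assumes feature: "feature_map h H ip \<psi>"
    and kernel: "\<And>y. (\<lambda>x. h x y) \<in> borel_measurable M"
    and P: "\<And>f. f \<in> borel_measurable M \<Longrightarrow> (\<integral>x. f x \<partial>P) = p * f a + q * f b"
  shows "mean_embedding H ip \<psi> P = (\<lambda>x. p * \<psi> a x + q * \<psi> b x)"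
proof (rule mean_embedding_eqI)
  have psi: "\<psi> x \<in> H" for x using feature by (simp add: feature_map_def)
  show "(\<lambda>x. p * \<psi> a x + q * \<psi> b x) \<in> H"
    by (intro add_mem scale_mem psi)
  fix f assume f: "f \<in> H"
  show "ip (\<lambda>x. p * \<psi> a x + q * \<psi> b x) f = (\<integral>x. ip (\<psi> x) f \<partial>P)"
    using P[OF measurable_ip_feature[OF feature kernel f]] f psi
    by (simp add: ip_add_left ip_scale_left scale_mem)
qed

end

lemma mmd_two_point:
  assumes "hilbert_function_space H ip"
    and feature: "feature_map h H ip \<psi>"
    and kernel: "\<And>y. (\<lambda>x. h x y) \<in> borel_measurable M"
    and P: "\<And>f. f \<in> borel_measurable M \<Longrightarrow> (\<integral>x. f x \<partial>P) = p * f a + q * f b"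
    and Q: "\<And>f. f \<in> borel_measurable M \<Longrightarrow>
      (\<integral>x. f x \<partial>Q) = (p + t) * f a + (q - t) * f b"
  shows "mmd H ip \<psi> P Q = \<bar>t\<bar> * sqrt (h a a - 2 * h a b + h b b)"
    and "mmd H ip \<psi> Q P = \<bar>t\<bar> * sqrt (h a a - 2 * h a b + h b b)"
proof -
  interpret hilbert_function_space H ip by fact
  have psi: "\<psi> x \<in> H" and psi_ip: "ip (\<psi> x) (\<psi> y) = h x y" for x y
    using feature by (auto simp: feature_map_def)
  note mP = mean_embedding_two_point[OF feature kernel P]
  note mQ = mean_embedding_two_point[OF feature kernel Q]
  have "(\<lambda>x. mean_embedding H ip \<psi> Q x - mean_embedding H ip \<psi> P x) =
      (\<lambda>x. t * (\<psi> a x - \<psi> b x))"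
    by (simp add: mP mQ algebra_simps)
  moreover have "ip (\<lambda>x. t * (\<psi> a x - \<psi> b x)) (\<lambda>x. t * (\<psi> a x - \<psi> b x)) =
      t\<^sup>2 * (h a a - 2 * h a b + h b b)"
    using diff_mem[OF psi psi, of a b]
    by (simp add: ip_scale_left ip_scale_right scale_mem ip_diff_self psi psi_ip power2_eq_square)
  ultimately show *: "mmd H ip \<psi> Q P = \<bar>t\<bar> * sqrt (h a a - 2 * h a b + h b b)"
    by (simp add: mmd_def ip_norm_def real_sqrt_mult)
  have "mean_embedding H ip \<psi> P \<in> H" "mean_embedding H ip \<psi> Q \<in> H"
    by (auto simp: mP mQ intro!: add_mem scale_mem psi)
  then show "mmd H ip \<psi> P Q = \<bar>t\<bar> * sqrt (h a a - 2 * h a b + h b b)"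
    unfolding * [symmetric] by (rule mmd_commute)
qed

section \<open>Product measures with a perturbed block\<close>

lemma PiM_density:
  assumes M: "product_sigma_finite M"
    and D: "product_sigma_finite (\<lambda>i. density (M i) (f i))"
    and I: "finite I"
    and f: "\<And>i. i \<in> I \<Longrightarrow> f i \<in> borel_measurable (M i)"
  shows "PiM I (\<lambda>i. density (M i) (f i)) = density (PiM I M) (\<lambda>x. \<Prod>i\<in>I. f i (x i))"
proof -
  interpret M: product_sigma_finite M by fact
  interpret D: product_sigma_finite "\<lambda>i. density (M i) (f i)" by fact
  note f[measurable]
  have meas: "(\<lambda>x. \<Prod>i\<in>I. f i (x i)) \<in> borel_measurable (PiM I M)"
    by measurable
  show ?thesis
  proof (rule D.PiM_eqI[OF I, symmetric])
    show "sets (density (PiM I M) (\<lambda>x. \<Prod>i\<in>I. f i (x i))) =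
        sets (PiM I (\<lambda>i. density (M i) (f i)))"
      by (simp cong: sets_PiM_cong)
    fix A assume A: "\<And>i. i \<in> I \<Longrightarrow> A i \<in> sets (density (M i) (f i))"
    then have A': "A i \<in> sets (M i)" if "i \<in> I" for i using that by simp
    have PA: "PiE I A \<in> sets (PiM I M)" by (intro sets_PiM_I_finite I A')
    have "emeasure (density (PiM I M) (\<lambda>x. \<Prod>i\<in>I. f i (x i))) (PiE I A) =
        (\<integral>\<^sup>+x. (\<Prod>i\<in>I. f i (x i)) * indicator (PiE I A) x \<partial>PiM I M)"
      by (rule emeasure_density[OF meas PA])
    also have "\<dots> = (\<integral>\<^sup>+x. (\<Prod>i\<in>I. f i (x i) * indicator (A i) (x i)) \<partial>PiM I M)"
    proof (rule nn_integral_cong)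
      fix x assume "x \<in> space (PiM I M)"
      then have "x \<in> extensional I" by (auto simp: space_PiM PiE_def)
      then have "indicator (PiE I A) x = (\<Prod>i\<in>I. indicator (A i) (x i) :: ennreal)"
        using I by (auto simp: indicator_def PiE_def Pi_def)
      then show "(\<Prod>i\<in>I. f i (x i)) * indicator (PiE I A) x =
          (\<Prod>i\<in>I. f i (x i) * indicator (A i) (x i))"
        by (simp add: prod.distrib)
    qed
    also have "\<dots> = (\<Prod>i\<in>I. \<integral>\<^sup>+x. f i x * indicator (A i) x \<partial>M i)"
      by (rule M.product_nn_integral_prod[OF I]) (use A' f in measurable)
    also have "\<dots> = (\<Prod>i\<in>I. emeasure (density (M i) (f i)) (A i))"
      by (intro prod.cong refl emeasure_density[symmetric] f A')
    finally show "emeasure (density (PiM I M) (\<lambda>x. \<Prod>i\<in>I. f i (x i))) (PiE I A) =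
        (\<Prod>i\<in>I. emeasure (density (M i) (f i)) (A i))" .
  qed
qed

text \<open>The law with density \<open>g\<close> on the block \<open>j\<close> has likelihood ratio \<open>L j\<close>, a product of
  copies of \<open>g\<close>. Ratios of distinct blocks are uncorrelated, so the average of the \<open>L j\<close> has mean \<open>1\<close>
  and variance at most \<open>V / card J\<close>; no event can then have a much smaller average probability
  than it has under the unperturbed product.\<close>

lemma mixture_lower_bound:
  fixes M :: "'a measure" and g :: "'a \<Rightarrow> real" and blk :: "'i \<Rightarrow> 'k" and V \<epsilon> \<gamma> C :: real
  assumes M: "prob_space M"
    and g: "g \<in> borel_measurable M" "\<And>x. 0 \<le> g x" "\<And>x. g x \<le> C"
    and g1: "(\<integral>x. g x \<partial>M) = 1" and g2: "(\<integral>x. (g x)\<^sup>2 \<partial>M) = 1 + \<gamma>"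
    and I: "finite I" and J: "finite J" "J \<noteq> {}"
    and V: "\<And>j. j \<in> J \<Longrightarrow> (1 + \<gamma>) ^ card {i\<in>I. blk i = j} \<le> V"
    and A: "A \<in> sets (PiM I (\<lambda>_. M))"
    and eps: "0 < \<epsilon>"
  shows "measure (PiM I (\<lambda>_. M)) A - \<epsilon> - V / (4 * \<epsilon> * real (card J)) \<le>
    (\<Sum>j\<in>J. measure (PiM I (\<lambda>i. if blk i = j then density M g else M)) A) / real (card J)"
proof -
  interpret M: prob_space M by fact
  interpret PM: product_prob_space "\<lambda>_. M" I
    by (intro product_prob_spaceI M)
  interpret PM: finite_product_prob_space "\<lambda>_. M" I
    by standard fact
  let ?P = "PiM I (\<lambda>_. M)"
  note g(1)[measurable]
  have int_bdd: "integrable M f" if "f \<in> borel_measurable M" "\<And>x. \<bar>f x\<bar> \<le> c" for f :: "'a \<Rightarrow> real" and c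
    using that by (intro M.integrable_const_bound[of _ c]) auto
  have C: "0 \<le> C" using g(2,3) order_trans by blast
  have int_g: "integrable M g" using g by (intro int_bdd[of _ C]) auto
  have int_g2: "integrable M (\<lambda>x. (g x)\<^sup>2)"
    using g by (intro int_bdd[of _ "C\<^sup>2"]) (auto intro: power_mono)
  define w where "w j i x = (if blk i = j then g x else 1)" for j i x
  define L where "L j \<omega> = (\<Prod>i\<in>I. w j i (\<omega> i))" for j \<omega>
  have w_meas[measurable]: "w j i \<in> borel_measurable M" for j i
    unfolding w_def by measurable
  have L_meas[measurable]: "L j \<in> borel_measurable ?P" for j
    unfolding L_def by measurable
  have w_nn: "0 \<le> w j i x" for j i x by (simp add: w_def g)
  have L_nn: "0 \<le> L j \<omega>" for j \<omega> unfolding L_def by (intro prod_nonneg ballI w_nn)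

  have law: "measure (PiM I (\<lambda>i. if blk i = j then density M g else M)) A =
      (\<integral>\<omega>. L j \<omega> * indicator A \<omega> \<partial>?P)" for j
  proof -
    have dens: "prob_space (density M g)"
    proof (rule prob_spaceI)
      show "emeasure (density M g) (space (density M g)) = 1"
        using nn_integral_eq_integral[OF int_g] g g1
        by (simp add: emeasure_density cong: nn_integral_cong)
    qed
    have eq: "(if blk i = j then density M g else M) = density M (\<lambda>x. ennreal (w j i x))" for i
      by (simp add: w_def density_1)
    have ps: "product_sigma_finite (\<lambda>i. density M (\<lambda>x. ennreal (w j i x)))"
      unfolding eq[symmetric]
      by (intro product_sigma_finite.intro)
        (use dens M in \<open>auto intro: prob_space_imp_sigma_finite\<close>)
    have "PiM I (\<lambda>i. if blk i = j then density M g else M) =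
        density ?P (\<lambda>\<omega>. \<Prod>i\<in>I. ennreal (w j i (\<omega> i)))"
      unfolding eq
      by (rule PiM_density[OF _ ps I]) (auto intro: PM.product_sigma_finite_axioms)
    also have "\<dots> = density ?P (\<lambda>\<omega>. ennreal (L j \<omega>))"
      unfolding L_def by (simp add: prod_ennreal w_nn)
    finally have *: "PiM I (\<lambda>i. if blk i = j then density M g else M) =
        density ?P (\<lambda>\<omega>. ennreal (L j \<omega>))" .
    have "measure (density ?P (\<lambda>\<omega>. ennreal (L j \<omega>))) A =
        (\<integral>\<omega>. indicator A \<omega> \<partial>density ?P (\<lambda>\<omega>. ennreal (L j \<omega>)))"
      using sets.sets_into_space[OF A] by (simp add: Int_absorb2)
    also have "\<dots> = (\<integral>\<omega>. L j \<omega> * indicator A \<omega> \<partial>?P)"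
      using A L_nn by (intro integral_real_density) auto
    finally show ?thesis using * by simp
  qed

  have EL: "integrable ?P (L j)" "(\<integral>\<omega>. L j \<omega> \<partial>?P) = 1" for j
  proof -
    have iw: "integrable M (w j i)" for i
      by (cases "blk i = j") (simp_all add: w_def[abs_def] int_g)
    have Ew: "(\<integral>x. w j i x \<partial>M) = 1" for i
      by (cases "blk i = j") (simp_all add: w_def g1 M.prob_space)
    show "integrable ?P (L j)"
      unfolding L_def by (intro PM.product_integrable_prod I iw)
    show "(\<integral>\<omega>. L j \<omega> \<partial>?P) = 1"
      unfolding L_def by (subst PM.product_integral_prod[OF I iw]) (simp_all add: Ew)
  qed

  have ELL: "integrable ?P (\<lambda>\<omega>. L j \<omega> * L k \<omega>)"
    "(\<integral>\<omega>. L j \<omega> * L k \<omega> \<partial>?P) = (if j = k then (1 + \<gamma>) ^ card {i\<in>I. blk i = j} else 1)" for j k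
  proof -
    have LL: "L j \<omega> * L k \<omega> = (\<Prod>i\<in>I. w j i (\<omega> i) * w k i (\<omega> i))" for \<omega>
      unfolding L_def by (simp add: prod.distrib)
    have iw: "integrable M (\<lambda>x. w j i x * w k i x)" for i
      using int_g int_g2
      by (cases "blk i = j"; cases "blk i = k") (simp_all add: w_def power2_eq_square)
    have Ew: "(\<integral>x. w j i x * w k i x \<partial>M) = (if j = k \<and> blk i = j then 1 + \<gamma> else 1)" for i
      using g1 g2
      by (cases "blk i = j"; cases "blk i = k")
        (auto simp: w_def M.prob_space power2_eq_square)
    show "integrable ?P (\<lambda>\<omega>. L j \<omega> * L k \<omega>)"
      unfolding LL by (intro PM.product_integrable_prod[of _ "\<lambda>i x. w j i x * w k i x"] I iw)
    have "(\<integral>\<omega>. L j \<omega> * L k \<omega> \<partial>?P) = (\<Prod>i\<in>I. \<integral>x. w j i x * w k i x \<partial>M)"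
      unfolding LL
      by (rule PM.product_integral_prod[OF I, of "\<lambda>i x. w j i x * w k i x"]) (rule iw)
    also have "\<dots> = (if j = k then (1 + \<gamma>) ^ card {i\<in>I. blk i = j} else 1)"
      by (auto simp: Ew prod.If_cases I Int_def)
    finally show "(\<integral>\<omega>. L j \<omega> * L k \<omega> \<partial>?P) =
        (if j = k then (1 + \<gamma>) ^ card {i\<in>I. blk i = j} else 1)" .
  qed

  let ?K = "real (card J)"
  have K: "0 < ?K" using J by (simp add: card_gt_0_iff)
  define Lb where "Lb \<omega> = (\<Sum>j\<in>J. L j \<omega>) / ?K" for \<omega>
  have int_Lb: "integrable ?P Lb" "(\<integral>\<omega>. Lb \<omega> \<partial>?P) = 1"
    unfolding Lb_def using EL K by auto
  have Lb_sq: "(Lb \<omega>)\<^sup>2 = (\<Sum>j\<in>J. \<Sum>k\<in>J. L j \<omega> * L k \<omega>) / ?K\<^sup>2" for \<omega>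
    by (simp add: Lb_def power_divide power2_eq_square sum_product)
  have int_Lb2: "integrable ?P (\<lambda>\<omega>. (Lb \<omega>)\<^sup>2)"
    unfolding Lb_sq using ELL by auto
  have second: "(\<integral>\<omega>. (Lb \<omega>)\<^sup>2 \<partial>?P) \<le> 1 + V / ?K"
  proof -
    have "(\<integral>\<omega>. (Lb \<omega>)\<^sup>2 \<partial>?P) =
        (\<Sum>j\<in>J. \<Sum>k\<in>J. (if j = k then (1 + \<gamma>) ^ card {i\<in>I. blk i = j} else 1)) / ?K\<^sup>2"
      unfolding Lb_sq using ELL by (simp add: Bochner_Integration.integral_sum)
    also have "\<dots> \<le> (\<Sum>j\<in>J. \<Sum>k\<in>J. 1 + (if j = k then V else 0)) / ?K\<^sup>2"
    proof (intro divide_right_mono sum_mono)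
      fix j k assume "j \<in> J" "k \<in> J"
      then show "(if j = k then (1 + \<gamma>) ^ card {i\<in>I. blk i = j} else 1)
          \<le> 1 + (if j = k then V else 0)"
        using V[of j] by auto
    qed simp
    also have "\<dots> = 1 + V / ?K"
      using K J by (simp add: sum.distrib power2_eq_square field_simps)
    finally show ?thesis .
  qed

  have ind[measurable]: "indicator A \<in> borel_measurable ?P" using A by simp
  have int_LA: "integrable ?P (\<lambda>\<omega>. L j \<omega> * indicator A \<omega>)" for j
    using integrable_mult_indicator[OF A EL(1)[of j]] by (simp add: mult.commute)
  have int_LbA: "integrable ?P (\<lambda>\<omega>. Lb \<omega> * indicator A \<omega>)"
    using integrable_mult_indicator[OF A int_Lb(1)] by (simp add: mult.commute)
  have int_A: "integrable ?P (indicator A :: _ \<Rightarrow> real)"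
    using A PM.finite_measure_axioms
    by (auto simp: less_top[symmetric] PM.emeasure_finite)
  have avg: "(\<Sum>j\<in>J. measure (PiM I (\<lambda>i. if blk i = j then density M g else M)) A) / ?K =
      (\<integral>\<omega>. Lb \<omega> * indicator A \<omega> \<partial>?P)"
    unfolding law Lb_def using int_LA
    by (simp add: sum_distrib_right)
  have "measure ?P A - (\<integral>\<omega>. Lb \<omega> * indicator A \<omega> \<partial>?P) =
      (\<integral>\<omega>. indicator A \<omega> - Lb \<omega> * indicator A \<omega> \<partial>?P)"
    using int_A int_LbA sets.sets_into_space[OF A]
    by (simp add: Int_absorb2)
  also have "\<dots> \<le> (\<integral>\<omega>. \<epsilon> + ((Lb \<omega>)\<^sup>2 - 2 * Lb \<omega> + 1) / (4 * \<epsilon>) \<partial>?P)"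
  proof (rule integral_mono)
    show "integrable ?P (\<lambda>\<omega>. indicator A \<omega> - Lb \<omega> * indicator A \<omega>)"
      using int_A int_LbA by simp
    show "integrable ?P (\<lambda>\<omega>. \<epsilon> + ((Lb \<omega>)\<^sup>2 - 2 * Lb \<omega> + 1) / (4 * \<epsilon>))"
      using int_Lb int_Lb2 by simp
    fix \<omega>
    \<comment> \<open>A linearised Cauchy-Schwarz inequality.\<close>
    have "(1 - Lb \<omega>) * (4 * \<epsilon>) \<le> 4 * \<epsilon>\<^sup>2 + (1 - Lb \<omega>)\<^sup>2"
      using zero_le_power2[of "2 * \<epsilon> - (1 - Lb \<omega>)"]
      by (simp add: power2_eq_square algebra_simps)
    then have "1 - Lb \<omega> \<le> \<epsilon> + (1 - Lb \<omega>)\<^sup>2 / (4 * \<epsilon>)"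
      using eps by (simp add: field_simps power2_eq_square)
    moreover have "0 \<le> \<epsilon> + (1 - Lb \<omega>)\<^sup>2 / (4 * \<epsilon>)" using eps by simp
    moreover have "(1 - Lb \<omega>)\<^sup>2 = (Lb \<omega>)\<^sup>2 - 2 * Lb \<omega> + 1"
      by (simp add: power2_eq_square algebra_simps)
    ultimately show "indicator A \<omega> - Lb \<omega> * indicator A \<omega> \<le>
        \<epsilon> + ((Lb \<omega>)\<^sup>2 - 2 * Lb \<omega> + 1) / (4 * \<epsilon>)"
      by (auto simp: indicator_def)
  qed
  also have "\<dots> = \<epsilon> + ((\<integral>\<omega>. (Lb \<omega>)\<^sup>2 \<partial>?P) - 1) / (4 * \<epsilon>)"
    using int_Lb int_Lb2 PM.P.prob_space by simp
  also have "\<dots> \<le> \<epsilon> + (V / ?K) / (4 * \<epsilon>)"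
    using second eps by (intro add_left_mono divide_right_mono) auto
  finally show ?thesis unfolding avg by (simp add: field_simps)
qed

lemma sample_of_bounds:
  assumes "1 \<le> i" "i \<le> total_size K n"
  shows "sample_of n i \<in> {1..K}"
    and "(\<Sum>j=1..sample_of n i - 1. n j) < i" "i \<le> (\<Sum>j=1..sample_of n i. n j)"
proof -
  have K: "i \<le> (\<Sum>j=1..K. n j)" using assms by (simp add: total_size_def)
  show up: "i \<le> (\<Sum>j=1..sample_of n i. n j)"
    unfolding sample_of_def using K by (rule LeastI)
  have "sample_of n i \<noteq> 0" using up assms(1) by (cases "sample_of n i = 0") auto
  moreover have "sample_of n i \<le> K"
    unfolding sample_of_def using K by (rule Least_le)
  ultimately show "sample_of n i \<in> {1..K}" by simp
  have "sample_of n i - 1 < sample_of n i" using \<open>sample_of n i \<noteq> 0\<close> by simp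
  then show "(\<Sum>j=1..sample_of n i - 1. n j) < i"
    unfolding sample_of_def using not_less_Least not_le by blast
qed

lemma card_sample_le:
  assumes j: "1 \<le> j"
  shows "card {i \<in> {1..total_size K n}. sample_of n i = j} \<le> n j"
proof -
  have "{i \<in> {1..total_size K n}. sample_of n i = j} \<subseteq>
      {(\<Sum>l=1..j - 1. n l)<..(\<Sum>l=1..j. n l)}"
    using sample_of_bounds(2,3)[of _ K n] by auto
  then have "card {i \<in> {1..total_size K n}. sample_of n i = j} \<le>
      card {(\<Sum>l=1..j - 1. n l)<..(\<Sum>l=1..j. n l)}"
    by (intro card_mono) auto
  also have "\<dots> = n j"
    using j by (cases j) (auto simp: sum.cl_ivl_Suc)
  finally show ?thesis .
qed

section \<open>Two-point laws\<close>

text \<open>The uniform law on two points, as a measure on the Borel sets (for equal points, the point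
  mass there).\<close>

definition fair_coin :: "'a::topological_space \<Rightarrow> 'a \<Rightarrow> 'a measure" where
  "fair_coin a b = distr (measure_pmf (pmf_of_set {a, b})) borel (\<lambda>x. x)"

text \<open>A density with respect to the uniform law on \<open>a\<close> and a second point: it moves the mass
  \<open>\<eta> / 2\<close> from the second point to \<open>a\<close>. Its value off \<open>a\<close> is constant, so that the second
  point is not a parameter.\<close>

definition tilt :: "'a \<Rightarrow> real \<Rightarrow> 'a \<Rightarrow> real" where
  "tilt a \<eta> x = (if x = a then 1 + \<eta> else 1 - \<eta>)"

lemma sets_fair_coin [simp, measurable_cong]: "sets (fair_coin a b) = sets borel"
  by (simp add: fair_coin_def)

lemma space_fair_coin [simp]: "space (fair_coin a b) = UNIV"
  by (simp add: fair_coin_def)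

lemma prob_space_fair_coin: "prob_space (fair_coin a b)"
  unfolding fair_coin_def by (intro prob_space.prob_space_distr measure_pmf.prob_space_axioms) auto

lemma integral_fair_coin:
  fixes f :: "'a::topological_space \<Rightarrow> real"
  assumes "a \<noteq> b" "f \<in> borel_measurable borel"
  shows "(\<integral>x. f x \<partial>fair_coin a b) = (f a + f b) / 2"
  unfolding fair_coin_def using assms by (simp add: integral_distr integral_pmf_of_set)

lemma measurable_tilt [measurable]:
  "tilt (a::'a::t1_space) \<eta> \<in> borel_measurable borel"
  unfolding tilt_def by measurable

lemma tilt_bounds:
  assumes "0 \<le> \<eta>" "\<eta> \<le> 1"
  shows "0 \<le> tilt a \<eta> x" "tilt a \<eta> x \<le> 2"
  using assms by (auto simp: tilt_def)

lemma integral_tilted_coin: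
  fixes f :: "'a::t1_space \<Rightarrow> real"
  assumes "a \<noteq> b" "0 \<le> \<eta>" "\<eta> \<le> 1" and [measurable]: "f \<in> borel_measurable borel"
  shows "(\<integral>x. f x \<partial>density (fair_coin a b) (tilt a \<eta>)) =
    (1/2 + \<eta>/2) * f a + (1/2 - \<eta>/2) * f b"
proof -
  have "(\<integral>x. f x \<partial>density (fair_coin a b) (tilt a \<eta>)) =
      (\<integral>x. tilt a \<eta> x * f x \<partial>fair_coin a b)"
    using tilt_bounds(1)[OF assms(2,3), of a] by (intro integral_real_density AE_I2) auto
  also have "\<dots> = (tilt a \<eta> a * f a + tilt a \<eta> b * f b) / 2"
    using assms(1) by (intro integral_fair_coin) auto
  finally show ?thesis
    using assms(1) by (simp add: tilt_def field_simps)
qed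

lemma prob_space_tilted_coin:
  fixes a b :: "'a::t1_space"
  assumes "a \<noteq> b" "0 \<le> \<eta>" "\<eta> \<le> 1"
  shows "prob_space (density (fair_coin a b) (tilt a \<eta>))"
proof -
  interpret prob_space "fair_coin a b" by (rule prob_space_fair_coin)
  have int: "integrable (fair_coin a b) (tilt a \<eta>)"
    using tilt_bounds[OF assms(2,3), of a] by (intro integrable_const_bound[of _ 2] AE_I2) auto
  have total: "(\<integral>x. tilt a \<eta> x \<partial>fair_coin a b) = 1"
    using assms(1) by (simp add: integral_fair_coin tilt_def)
  show ?thesis
  proof (rule prob_spaceI)
    have "emeasure (density (fair_coin a b) (tilt a \<eta>)) (space (fair_coin a b)) =
        (\<integral>\<^sup>+x. ennreal (tilt a \<eta> x) \<partial>fair_coin a b)"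
      by (subst emeasure_density) (auto cong: nn_integral_cong)
    also have "\<dots> = 1"
      using nn_integral_eq_integral[OF int] tilt_bounds(1)[OF assms(2,3), of a] total by simp
    finally show "emeasure (density (fair_coin a b) (tilt a \<eta>))
        (space (density (fair_coin a b) (tilt a \<eta>))) = 1" by simp
  qed
qed

section \<open>The minimax lower bound\<close>

lemma pooled_law_const: "pooled_law K n (\<lambda>_. M) = (\<Pi>\<^sub>M i\<in>{1..total_size K n}. M)"
  by (simp add: pooled_law_def)

lemma sets_pooled_law:
  assumes "P \<in> distribution_tuples K"
  shows "sets (pooled_law K n P) = sets (\<Pi>\<^sub>M i\<in>{1..total_size K n}. borel)"
  unfolding pooled_law_def
proof (rule sets_PiM_cong[OF refl])
  fix i assume "i \<in> {1..total_size K n}"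
  then have "sample_of n i \<in> {1..K}" by (intro sample_of_bounds) auto
  then have "P (sample_of n i) \<in> space (prob_algebra borel)"
    using assms by (auto simp: distribution_tuples_def)
  then show "sets (P (sample_of n i)) = sets borel" by (simp add: space_prob_algebra)
qed

lemma prob_accept_ge_of_level:
  assumes T: "T \<in> level_tests \<alpha> K n" and M: "M \<in> space (prob_algebra borel)"
  shows "1 - \<alpha> \<le> prob_test_eq K n (\<lambda>_. M) T 0"
proof -
  let ?L = "pooled_law K n (\<lambda>_. M)"
  have dist: "(\<lambda>_. M) \<in> distribution_tuples K" using M by (auto simp: distribution_tuples_def)
  have "prob_space M" using M by (simp add: space_prob_algebra)
  then interpret prob_space ?L
    unfolding pooled_law_def by (intro prob_space_PiM)
  have [measurable]: "T \<in> ?L \<rightarrow>\<^sub>M count_space {0, 1}"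
    using T measurable_cong_sets[OF sets_pooled_law[OF dist] refl] by (auto simp: level_tests_def)
  have "{z \<in> space ?L. T z = 0} = space ?L - {z \<in> space ?L. T z = 1}"
    using measurable_space[OF \<open>T \<in> ?L \<rightarrow>\<^sub>M count_space {0, 1}\<close>] by force
  then have "prob {z \<in> space ?L. T z = 0} = 1 - prob {z \<in> space ?L. T z = 1}"
    using prob_compl[of "{z \<in> space ?L. T z = 1}"] by simp
  moreover have "prob {z \<in> space ?L. T z = 1} \<le> \<alpha>"
    using T dist by (auto simp: level_tests_def prob_test_eq_def)
  ultimately show ?thesis by (simp add: prob_test_eq_def)
qed

lemma Max_mmd_ge:
  assumes "1 \<le> k" "k < l" "l \<le> (K::nat)" "r \<le> mmd H ip \<psi> (P k) (P l)"
  shows "r \<le> Max {mmd H ip \<psi> (P k) (P l) | k l. 1 \<le> k \<and> k < l \<and> l \<le> K}"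
proof -
  let ?X = "{mmd H ip \<psi> (P k) (P l) | k l. 1 \<le> k \<and> k < l \<and> l \<le> K}"
  have "?X \<subseteq> (\<lambda>(k, l). mmd H ip \<psi> (P k) (P l)) ` ({1..K} \<times> {1..K})" by force
  then have "finite ?X" by (rule finite_subset) simp
  moreover have "mmd H ip \<psi> (P k) (P l) \<in> ?X" using assms by blast
  ultimately show ?thesis using assms(4) Max_ge order_trans by blast
qed

lemma one_tilted_sample_sparse:
  fixes a b :: "'a::t1_space"
  assumes H: "hilbert_function_space H ip"
    and feature: "feature_map h H ip \<psi>"
    and kernel: "\<And>y. (\<lambda>x. h x y) \<in> borel_measurable borel"
    and ab: "a \<noteq> b" and eta: "0 \<le> \<eta>" "\<eta> \<le> 1"
    and K: "2 \<le> K" and j: "j \<in> {1..K}"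
    and r: "r \<le> \<eta> / 2 * sqrt (h a a - 2 * h a b + h b b)"
  shows "(\<lambda>k. if k = j then density (fair_coin a b) (tilt a \<eta>) else fair_coin a b)
    \<in> sparse_alternatives H ip \<psi> K r"
proof -
  let ?P = "fair_coin a b" and ?Q = "density (fair_coin a b) (tilt a \<eta>)"
  let ?A = "\<lambda>k. if k = j then ?Q else ?P"
  have P: "(\<integral>x. f x \<partial>?P) = 1/2 * f a + 1/2 * f b"
    if "f \<in> borel_measurable borel" for f :: "'a \<Rightarrow> real"
    using integral_fair_coin[OF ab that] by (simp add: add_divide_distrib)
  have Q: "(\<integral>x. f x \<partial>?Q) = (1/2 + \<eta>/2) * f a + (1/2 - \<eta>/2) * f b"
    if "f \<in> borel_measurable borel" for f :: "'a \<Rightarrow> real"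
    by (rule integral_tilted_coin[OF ab eta that])
  have "\<bar>\<eta> / 2\<bar> = \<eta> / 2" using eta by simp
  moreover note mmd_two_point[where p = "1/2" and q = "1/2" and t = "\<eta> / 2",
      OF H feature kernel P Q]
  ultimately have mmd: "r \<le> mmd H ip \<psi> ?P ?Q" "r \<le> mmd H ip \<psi> ?Q ?P"
    using r by (simp_all only:)
  \<comment> \<open>The maximum runs over ordered pairs, so the tilted sample is compared with sample \<open>1\<close>,
    or with sample \<open>2\<close> if it is the first one.\<close>
  have "r \<le> Max {mmd H ip \<psi> (?A k) (?A l) | k l. 1 \<le> k \<and> k < l \<and> l \<le> K}"
  proof (cases "j = 1")
    case True
    then show ?thesis using K True mmd
      by (intro Max_mmd_ge[where P = ?A and k = 1 and l = 2]) simp_all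
  next
    case False
    then show ?thesis using j False mmd
      by (intro Max_mmd_ge[where P = ?A and k = 1 and l = j]) simp_all
  qed
  moreover have "?A \<in> distribution_tuples K"
    using prob_space_fair_coin[of a b] prob_space_tilted_coin[OF ab eta]
    by (auto simp: distribution_tuples_def space_prob_algebra)
  ultimately show ?thesis by (simp add: sparse_alternatives_def)
qed

lemma minimax_type_two_lower_bound:
  fixes a b :: "'a::t1_space"
  assumes H: "hilbert_function_space H ip"
    and feature: "feature_map h H ip \<psi>"
    and kernel: "\<And>y. (\<lambda>x. h x y) \<in> borel_measurable borel"
    and ab: "a \<noteq> b" and eta: "0 \<le> \<eta>" "\<eta> \<le> 1"
    and K: "2 \<le> K"
    and r: "r \<le> \<eta> / 2 * sqrt (h a a - 2 * h a b + h b b)"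
    and V: "\<And>j. j \<in> {1..K} \<Longrightarrow> (1 + \<eta>\<^sup>2) ^ n j \<le> V"
    and eps: "0 < \<epsilon>"
    and T: "T \<in> level_tests \<alpha> K n"
  shows "ereal (1 - \<alpha> - \<epsilon> - V / (4 * \<epsilon> * real K)) \<le>
    (SUP P \<in> sparse_alternatives H ip \<psi> K r. ereal (prob_test_eq K n P T 0))"
proof -
  let ?I = "{1..total_size K n}"
  let ?P = "fair_coin a b" and ?Q = "density (fair_coin a b) (tilt a \<eta>)"
  let ?A = "\<lambda>j k. if k = j then ?Q else ?P"
  let ?Acc = "{z \<in> space (pooled_law K n (\<lambda>_. ?P)). T z = 0}"
  have P: "?P \<in> space (prob_algebra borel)"
    using prob_space_fair_coin by (simp add: space_prob_algebra)
  have sparse: "?A j \<in> sparse_alternatives H ip \<psi> K r" if "j \<in> {1..K}" for j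
    by (rule one_tilted_sample_sparse[OF H feature kernel ab eta K that r])
  have dist0: "(\<lambda>_. ?P) \<in> distribution_tuples K" using P by (auto simp: distribution_tuples_def)
  have sets_eq: "sets (pooled_law K n (?A j)) = sets (pooled_law K n (\<lambda>_. ?P))"
    if "j \<in> {1..K}" for j
    using sets_pooled_law[OF dist0] sets_pooled_law[of "?A j" K n] sparse[OF that]
    by (simp add: sparse_alternatives_def)
  have acc: "prob_test_eq K n (?A j) T 0 =
      measure (\<Pi>\<^sub>M i\<in>?I. if sample_of n i = j then ?Q else ?P) ?Acc" if "j \<in> {1..K}" for j
    using sets_eq_imp_space_eq[OF sets_eq[OF that]] unfolding prob_test_eq_def pooled_law_def
    by simp
  have "T \<in> pooled_law K n (\<lambda>_. ?P) \<rightarrow>\<^sub>M count_space {0, 1}"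
    using T measurable_cong_sets[OF sets_pooled_law[OF dist0] refl] by (auto simp: level_tests_def)
  then have Acc: "?Acc \<in> sets (\<Pi>\<^sub>M i\<in>?I. ?P)"
    unfolding pooled_law_const[symmetric] by measurable
  have "measure (\<Pi>\<^sub>M i\<in>?I. ?P) ?Acc - \<epsilon> - V / (4 * \<epsilon> * real (card {1..K})) \<le>
    (\<Sum>j\<in>{1..K}. measure (\<Pi>\<^sub>M i\<in>?I. if sample_of n i = j then ?Q else ?P) ?Acc)
      / real (card {1..K})"
  proof (rule mixture_lower_bound[where C = 2 and \<gamma> = "\<eta>\<^sup>2"])
    show "(\<integral>x. tilt a \<eta> x \<partial>?P) = 1"
      using ab by (simp add: integral_fair_coin tilt_def)
    show "(\<integral>x. (tilt a \<eta> x)\<^sup>2 \<partial>?P) = 1 + \<eta>\<^sup>2"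
      using ab by (simp add: integral_fair_coin tilt_def power2_eq_square field_simps)
    fix j assume j: "j \<in> {1..K}"
    have "(1 + \<eta>\<^sup>2) ^ card {i \<in> ?I. sample_of n i = j} \<le> (1 + \<eta>\<^sup>2) ^ n j"
      using j by (intro power_increasing card_sample_le) auto
    then show "(1 + \<eta>\<^sup>2) ^ card {i \<in> ?I. sample_of n i = j} \<le> V"
      using V[OF j] by linarith
  qed (use prob_space_fair_coin tilt_bounds[OF eta] K Acc eps in auto)
  moreover have "1 - \<alpha> \<le> measure (\<Pi>\<^sub>M i\<in>?I. ?P) ?Acc"
    using prob_accept_ge_of_level[OF T P] by (simp add: prob_test_eq_def pooled_law_const)
  ultimately have "1 - \<alpha> - \<epsilon> - V / (4 * \<epsilon> * real K) \<le>
      (\<Sum>j\<in>{1..K}. prob_test_eq K n (?A j) T 0) / real K"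
    using acc by simp
  then have avg: "real K * (1 - \<alpha> - \<epsilon> - V / (4 * \<epsilon> * real K)) \<le>
      (\<Sum>j\<in>{1..K}. prob_test_eq K n (?A j) T 0)"
    using K by (simp add: pos_le_divide_eq mult.commute)
  \<comment> \<open>Some component accepts with at least the average probability.\<close>
  have "\<exists>j\<in>{1..K}. 1 - \<alpha> - \<epsilon> - V / (4 * \<epsilon> * real K) \<le> prob_test_eq K n (?A j) T 0"
  proof (rule ccontr)
    assume "\<not> ?thesis"
    then have "(\<Sum>j\<in>{1..K}. prob_test_eq K n (?A j) T 0) <
        (\<Sum>j\<in>{1..K}. 1 - \<alpha> - \<epsilon> - V / (4 * \<epsilon> * real K))"
      using K by (intro sum_strict_mono) (auto simp: not_le)
    then show False using avg by simp
  qed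
  then obtain j where j: "j \<in> {1..K}"
    "1 - \<alpha> - \<epsilon> - V / (4 * \<epsilon> * real K) \<le> prob_test_eq K n (?A j) T 0"
    by blast
  show ?thesis
    by (rule SUP_upper2[OF sparse[OF j(1)]]) (use j(2) in simp)
qed

text \<open>With \<open>\<eta> = s * rate K n\<close>, the chi-square bound \<open>exp (\<eta>\<^sup>2 n\<^sub>j)\<close> is a power of \<open>K\<close>
  with exponent at most \<open>s\<^sup>2 n_max / n_min\<close>; balanced sample sizes make it at most \<open>1/2\<close>.\<close>

lemma likelihood_second_moment_le:
  assumes K: "2 \<le> K" and n: "\<And>k. k \<in> {1..K} \<Longrightarrow> 1 \<le> n k"
    and ratio: "real (n_max K n) / real (n_min K n) \<le> c"
    and s: "s\<^sup>2 * c \<le> 1/2" and j: "j \<in> {1..K}"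
  shows "(1 + (s * rate K n)\<^sup>2) ^ n j \<le> sqrt (real K)"
proof -
  have fin: "finite (n ` {1..K})" "n ` {1..K} \<noteq> {}" using K by auto
  have min: "1 \<le> n_min K n" using fin n by (simp add: n_min_def)
  have max: "n j \<le> n_max K n" using fin j by (simp add: n_max_def)
  have lnK: "0 \<le> ln (real K)" using K by simp
  have "(1 + (s * rate K n)\<^sup>2) ^ n j \<le> exp ((s * rate K n)\<^sup>2) ^ n j"
    by (intro power_mono exp_ge_add_one_self) auto
  also have "\<dots> = exp (real (n j) * (s * rate K n)\<^sup>2)"
    by (simp add: exp_of_nat_mult)
  also have "\<dots> \<le> exp (1/2 * ln (real K))"
  proof -
    have "(s * rate K n)\<^sup>2 = s\<^sup>2 * (ln (real K) / real (n_min K n))"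
      using lnK by (simp add: rate_def power_mult_distrib)
    then have "real (n j) * (s * rate K n)\<^sup>2 =
        (s\<^sup>2 * (real (n j) / real (n_min K n))) * ln (real K)" by simp
    also have "\<dots> \<le> (s\<^sup>2 * c) * ln (real K)"
      using max ratio lnK min
      by (intro mult_right_mono mult_left_mono order_trans[OF _ ratio] divide_right_mono) auto
    also have "\<dots> \<le> 1/2 * ln (real K)" using s lnK by (intro mult_right_mono) auto
    finally show ?thesis by simp
  qed
  also have "\<dots> = sqrt (real K)"
    using K by (simp add: powr_half_sqrt[symmetric] powr_def)
  finally show ?thesis .
qed

theorem theorem6p2:
  fixes h :: "real ^ 'd \<Rightarrow> real ^ 'd \<Rightarrow> real"
    and \<phi> :: "real ^ 'd \<Rightarrow> real"
    and H :: "(real ^ 'd \<Rightarrow> real) set"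
    and ip :: "(real ^ 'd \<Rightarrow> real) \<Rightarrow> (real ^ 'd \<Rightarrow> real) \<Rightarrow> real"
    and \<psi> :: "real ^ 'd \<Rightarrow> (real ^ 'd \<Rightarrow> real)"
    and z :: "real ^ 'd"
    and \<alpha> \<zeta> \<kappa>1 \<kappa>2 B c :: real
    and K :: "nat \<Rightarrow> nat"
    and n :: "nat \<Rightarrow> nat \<Rightarrow> nat"
  assumes alpha: "0 < \<alpha>" "\<alpha> < 1"
    and zeta: "0 < \<zeta>" "\<zeta> < 1 - \<alpha>"
    and translation_invariant: "translation_invariant_with h \<phi>"
    and measurable: "\<phi> \<in> borel_measurable borel"
    and rkhs: "rkhs h H ip"
    and feature_map: "feature_map h H ip \<psi>"
    and K_ge: "\<And>m. 2 \<le> K m"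
    and n_ge: "\<And>m k. k \<in> {1..K m} \<Longrightarrow> 1 \<le> n m k"
    and n_min_lim: "filterlim (\<lambda>m. n_min (K m) (n m)) at_top sequentially"
    and K_lim: "filterlim K at_top sequentially"
    and kappa1: "0 < \<kappa>1" "\<phi> 0 - \<phi> z \<ge> \<kappa>1"
    and kappa2: "0 < \<kappa>2" "\<And>m. rate (K m) (n m) \<le> \<kappa>2"
    and B1: "\<And>x y. 0 \<le> h x y \<and> h x y \<le> B"
    and B2: "0 < c" "\<And>m. real (n_max (K m) (n m)) / real (n_min (K m) (n m)) \<le> c"
  shows "\<exists>b>0. liminf (\<lambda>m.
            INF T \<in> level_tests \<alpha> (K m) (n m).
              SUP P \<in> sparse_alternatives H ip \<psi> (K m) (b * rate (K m) (n m)).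
                ereal (prob_test_eq (K m) (n m) P T 0)) \<ge> ereal \<zeta>"
proof -
  have hilb: "hilbert_function_space H ip" using rkhs by (simp add: rkhs_def)
  have h: "h x y = \<phi> (x - y)" and sym: "\<phi> (- x) = \<phi> x" for x y
    using translation_invariant
    by (auto simp: translation_invariant_with_def symmetric_positive_definite_def)
  note measurable[measurable]
  have kernel: "(\<lambda>x. h x y) \<in> borel_measurable borel" for y unfolding h by measurable
  have z: "0 \<noteq> z" using kappa1 by auto
  \<comment> \<open>The tilt is \<open>\<eta> = s * rate\<close>. The first term of the minimum gives \<open>\<eta> \<le> 1\<close>, so that the
    tilted law is a probability, and the second gives \<open>s\<^sup>2 * c \<le> 1/2\<close>.\<close>
  define s where "s = min (1 / \<kappa>2) (1 / sqrt (2 * c))"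
  have s: "0 < s" "s \<le> 1 / \<kappa>2" using kappa2 B2 by (auto simp: s_def)
  have sc: "s\<^sup>2 * c \<le> 1/2"
  proof -
    have "s\<^sup>2 \<le> (1 / sqrt (2 * c))\<^sup>2" using s by (intro power_mono) (auto simp: s_def)
    then show ?thesis using B2(1) by (simp add: power_divide field_simps)
  qed
  \<comment> \<open>The discrepancy of the two laws is \<open>\<eta> / 2\<close> times \<open>sqrt (2 * (\<phi> 0 - \<phi> z))\<close>, hence at
    least \<open>b * rate\<close>.\<close>
  define b where "b = s * sqrt (\<kappa>1 / 2)"
  have b: "0 < b" using s kappa1 by (simp add: b_def)
  \<comment> \<open>The margin is split between the slack \<open>\<epsilon>\<close> and the vanishing variance term.\<close>
  define \<epsilon> where "\<epsilon> = (1 - \<alpha> - \<zeta>) / 2"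
  have eps: "0 < \<epsilon>" using zeta by (simp add: \<epsilon>_def)
  have bound: "ereal (1 - \<alpha> - \<epsilon> - sqrt (real (K m)) / (4 * \<epsilon> * real (K m))) \<le>
      (SUP P \<in> sparse_alternatives H ip \<psi> (K m) (b * rate (K m) (n m)).
        ereal (prob_test_eq (K m) (n m) P T 0))"
    if T: "T \<in> level_tests \<alpha> (K m) (n m)" for m T
  proof (rule minimax_type_two_lower_bound[OF hilb feature_map kernel z _ _ K_ge _ _ eps T])
    have rate: "0 \<le> rate (K m) (n m)" using K_ge[of m] by (simp add: rate_def)
    show "0 \<le> s * rate (K m) (n m)" using s rate by simp
    have "s * rate (K m) (n m) \<le> 1 / \<kappa>2 * \<kappa>2" using s kappa2 rate by (intro mult_mono) auto
    then show "s * rate (K m) (n m) \<le> 1" using kappa2 by simp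
    have "sqrt (\<kappa>1 / 2) \<le> sqrt (2 * \<phi> 0 - 2 * \<phi> z) / 2"
      using real_sqrt_le_mono[of "\<kappa>1 / 2" "(2 * \<phi> 0 - 2 * \<phi> z) / 4"] kappa1(2)
      unfolding real_sqrt_divide by simp
    then have "(s * rate (K m) (n m)) * sqrt (\<kappa>1 / 2) \<le>
        (s * rate (K m) (n m)) * (sqrt (2 * \<phi> 0 - 2 * \<phi> z) / 2)"
      using s rate by (intro mult_left_mono) auto
    then show "b * rate (K m) (n m) \<le>
        s * rate (K m) (n m) / 2 * sqrt (h 0 0 - 2 * h 0 z + h z z)"
      by (simp add: b_def h sym algebra_simps)
    show "(1 + (s * rate (K m) (n m))\<^sup>2) ^ n m j \<le> sqrt (real (K m))" if "j \<in> {1..K m}" for j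
      by (rule likelihood_second_moment_le[OF K_ge n_ge B2(2) sc that])
  qed
  have "(\<lambda>k. sqrt (real k) / (4 * \<epsilon> * real k)) \<longlonglongrightarrow> 0"
    using eps by real_asymp
  then have "(\<lambda>m. sqrt (real (K m)) / (4 * \<epsilon> * real (K m))) \<longlonglongrightarrow> 0"
    by (rule filterlim_compose[OF _ K_lim])
  then have "\<forall>\<^sub>F m in sequentially. sqrt (real (K m)) / (4 * \<epsilon> * real (K m)) < \<epsilon>"
    using eps by (rule order_tendstoD)
  then have "\<forall>\<^sub>F m in sequentially. ereal \<zeta> \<le>
      (INF T \<in> level_tests \<alpha> (K m) (n m).
        SUP P \<in> sparse_alternatives H ip \<psi> (K m) (b * rate (K m) (n m)).
          ereal (prob_test_eq (K m) (n m) P T 0))"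
  proof eventually_elim
    case (elim m)
    have "ereal \<zeta> \<le> ereal (1 - \<alpha> - \<epsilon> - sqrt (real (K m)) / (4 * \<epsilon> * real (K m)))"
      using elim by (simp add: \<epsilon>_def field_simps)
    then show ?case
      using bound[of _ m] by (intro INF_greatest) (rule order_trans)
  qed
  then show ?thesis using b by (intro exI[of _ b]) (auto intro: Liminf_bounded)
qed

end
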